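(* Let $G$ be a simple graph with $n$ vertices. Then there exists a Coxeter group $W_M$, with set of generators $\Gamma=\{s_1,\ldots,s_n\}$, such that $G\cong\mathcal{C}(W_M,\Gamma)$.
   Context: A simple graph is an unweighted, undirected graph containing no loops or multiple edges. Coxeter groups: let $M=(m_{ij})_{1\leq i,j\leq n}$ be an $n\times n$ symmetric matrix with $m_{ij}\in\mathbb{N}\cup\{\infty\}$ such that $m_{ii}=1$ and $m_{ij}\geq 2$ if $i\neq j$. The Coxeter group of type $M$ is $$W_M=\langle s_1,\ldots,s_n \mid (s_is_j)^{m_{ij}}=1,\ 1\leq i,j\leq n,\ m_{ij}<\infty\rangle,$$ where $m_{ij}=\infty$ means that no relation of the form $(s_is_j)^m=1$ is imposed. Commuting graph: for a group $H$ and a nonempty subset $\Gamma\subseteq H$, the commuting graph $\mathcal{C}(H,\Gamma)$ is the simple graph with node set $\Gamma$ in which two distinct elements $x,y\in\Gamma$ are joined by an edge if and only if $x$ and $y$ commute in $H$. *)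

theory Defs
  imports "HOL-Algebra.Group" "HOL-Library.Extended_Nat" "Graph_Theory.Graph_Theory"
begin

text \<open>
  Group presentations. A word is a list of letters \<open>(x, b)\<close> with \<open>x\<close> a generator, where
  \<open>(x, True)\<close> stands for \<open>x\<close> and \<open>(x, False)\<close> for its inverse. The group
  \<open>\<langle>X | R\<rangle>\<close> is the set of words over \<open>X\<close> modulo the least congruence (for
  concatenation) that cancels mutually inverse adjacent letters and makes every relator trivial.
\<close>

type_synonym 'x gword = "('x \<times> bool) list"

definition gwords :: "'x set \<Rightarrow> 'x gword set" where
  "gwords X = lists (X \<times> UNIV)"

inductive_set pres_cong :: "'x set \<Rightarrow> 'x gword set \<Rightarrow> ('x gword \<times> 'x gword) set"
  for X :: "'x set" and R :: "'x gword set" where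
  refl: "u \<in> gwords X \<Longrightarrow> (u, u) \<in> pres_cong X R"
| sym: "(u, v) \<in> pres_cong X R \<Longrightarrow> (v, u) \<in> pres_cong X R"
| trans: "(u, v) \<in> pres_cong X R \<Longrightarrow> (v, w) \<in> pres_cong X R \<Longrightarrow> (u, w) \<in> pres_cong X R"
| append: "(u, u') \<in> pres_cong X R \<Longrightarrow> (v, v') \<in> pres_cong X R \<Longrightarrow> (u @ v, u' @ v') \<in> pres_cong X R"
| cancel: "x \<in> X \<Longrightarrow> ([(x, b), (x, \<not> b)], []) \<in> pres_cong X R"
| relator: "r \<in> R \<Longrightarrow> r \<in> gwords X \<Longrightarrow> (r, []) \<in> pres_cong X R"

definition presented_group :: "'x set \<Rightarrow> 'x gword set \<Rightarrow> 'x gword set monoid" where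
  "presented_group X R =
    \<lparr> carrier = gwords X // pres_cong X R,
      monoid.mult = (\<lambda>A B. \<Union>u\<in>A. \<Union>v\<in>B. pres_cong X R `` {u @ v}),
      one = pres_cong X R `` {[]} \<rparr>"

definition pres_gen :: "'x set \<Rightarrow> 'x gword set \<Rightarrow> 'x \<Rightarrow> 'x gword set" where
  "pres_gen X R x = pres_cong X R `` {[(x, True)]}"

lemma pres_cong_gwords: "(u, v) \<in> pres_cong X R \<Longrightarrow> u \<in> gwords X \<and> v \<in> gwords X"
  by (induction rule: pres_cong.induct) (auto simp: gwords_def)

lemma equiv_pres_cong: "equiv (gwords X) (pres_cong X R)"
  by (rule equivI)
    (auto intro!: refl_onI symI transI dest: pres_cong_gwords
      intro: pres_cong.refl pres_cong.sym pres_cong.trans)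

lemma presented_group_mult:
  assumes "u \<in> gwords X" "v \<in> gwords X"
  shows "pres_cong X R `` {u} \<otimes>\<^bsub>presented_group X R\<^esub> pres_cong X R `` {v} = pres_cong X R `` {u @ v}"
proof -
  have "congruent2 (pres_cong X R) (pres_cong X R) (\<lambda>u v. pres_cong X R `` {u @ v})"
    by (auto intro!: congruent2I' equiv_class_eq[OF equiv_pres_cong] pres_cong.append)
  from UN_equiv_class2[OF equiv_pres_cong equiv_pres_cong this assms]
  show ?thesis by (simp add: presented_group_def)
qed

lemma pres_cong_inverse:
  "u \<in> gwords X \<Longrightarrow> (rev (map (\<lambda>(x, b). (x, \<not> b)) u) @ u, []) \<in> pres_cong X R"
proof (induction u)
  case Nil
  then show ?case by (simp add: pres_cong.refl)
next
  case (Cons a u)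
  obtain x b where a: "a = (x, b)" by (cases a)
  let ?v = "rev (map (\<lambda>(x, b). (x, \<not> b)) u)"
  have x: "x \<in> X" and u: "u \<in> gwords X" using Cons.prems a by (auto simp: gwords_def)
  then have "?v \<in> gwords X" by (auto simp: gwords_def)
  moreover have "([(x, \<not> b), (x, b)], []) \<in> pres_cong X R"
    using pres_cong.cancel[of x X "\<not> b" R] x by simp
  ultimately have "(?v @ [(x, \<not> b), (x, b)] @ u, ?v @ [] @ u) \<in> pres_cong X R"
    using u by (intro pres_cong.append pres_cong.refl)
  then show ?case using Cons.IH[OF u] by (auto simp: a intro: pres_cong.trans)
qed

lemma group_presented_group: "group (presented_group X R)"
proof (rule groupI)
  note eq = equiv_class_eq[OF equiv_pres_cong]
  have one: "\<one>\<^bsub>presented_group X R\<^esub> = pres_cong X R `` {[]}" "[] \<in> gwords X"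
    by (auto simp: presented_group_def gwords_def)
  have app: "u @ v \<in> gwords X" if "u \<in> gwords X" "v \<in> gwords X" for u v
    using that by (simp add: gwords_def)
  have cl: "A \<in> carrier (presented_group X R) \<longleftrightarrow> (\<exists>u\<in>gwords X. A = pres_cong X R `` {u})" for A
    by (auto simp: presented_group_def quotient_def)
  show "\<one>\<^bsub>presented_group X R\<^esub> \<in> carrier (presented_group X R)"
    using one cl by blast
  fix A assume "A \<in> carrier (presented_group X R)"
  then obtain u where u: "u \<in> gwords X" "A = pres_cong X R `` {u}" using cl by blast
  show "\<one>\<^bsub>presented_group X R\<^esub> \<otimes>\<^bsub>presented_group X R\<^esub> A = A"
    using u one presented_group_mult by fastforce
  let ?v = "rev (map (\<lambda>(x, b). (x, \<not> b)) u)"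
  have v: "?v \<in> gwords X" using u by (auto simp: gwords_def)
  then have "pres_cong X R `` {?v} \<otimes>\<^bsub>presented_group X R\<^esub> A = \<one>\<^bsub>presented_group X R\<^esub>"
    using u eq[OF pres_cong_inverse[OF u(1)]] by (simp add: presented_group_mult one)
  then show "\<exists>B\<in>carrier (presented_group X R). B \<otimes>\<^bsub>presented_group X R\<^esub> A = \<one>\<^bsub>presented_group X R\<^esub>"
    using v cl by blast
  fix B assume "B \<in> carrier (presented_group X R)"
  then obtain v where v: "v \<in> gwords X" "B = pres_cong X R `` {v}" using cl by blast
  show "A \<otimes>\<^bsub>presented_group X R\<^esub> B \<in> carrier (presented_group X R)"
    using u v app cl presented_group_mult by metis
  fix C assume "C \<in> carrier (presented_group X R)"
  then obtain w where "w \<in> gwords X" "C = pres_cong X R `` {w}" using cl by blast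
  then show "A \<otimes>\<^bsub>presented_group X R\<^esub> B \<otimes>\<^bsub>presented_group X R\<^esub> C =
      A \<otimes>\<^bsub>presented_group X R\<^esub> (B \<otimes>\<^bsub>presented_group X R\<^esub> C)"
    using u v app by (simp add: presented_group_mult)
qed

text \<open>Only the entries of \<open>M\<close> with indices in \<open>{1..n}\<close> are meaningful.\<close>

definition coxeter_matrix :: "nat \<Rightarrow> (nat \<Rightarrow> nat \<Rightarrow> enat) \<Rightarrow> bool" where
  "coxeter_matrix n M \<longleftrightarrow>
    (\<forall>i\<in>{1..n}. \<forall>j\<in>{1..n}. M i j = M j i) \<and>
    (\<forall>i\<in>{1..n}. M i i = 1) \<and>
    (\<forall>i\<in>{1..n}. \<forall>j\<in>{1..n}. i \<noteq> j \<longrightarrow> M i j \<ge> 2)"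

definition coxeter_relators :: "nat \<Rightarrow> (nat \<Rightarrow> nat \<Rightarrow> enat) \<Rightarrow> nat gword set" where
  "coxeter_relators n M =
    {concat (replicate m [(i, True), (j, True)]) | i j m.
      i \<in> {1..n} \<and> j \<in> {1..n} \<and> M i j = enat m}"

definition coxeter_group :: "nat \<Rightarrow> (nat \<Rightarrow> nat \<Rightarrow> enat) \<Rightarrow> nat gword set monoid" where
  "coxeter_group n M = presented_group {1..n} (coxeter_relators n M)"

definition coxeter_gen :: "nat \<Rightarrow> (nat \<Rightarrow> nat \<Rightarrow> enat) \<Rightarrow> nat \<Rightarrow> nat gword set" where
  "coxeter_gen n M i = pres_gen {1..n} (coxeter_relators n M) i"

text \<open>
  A simple graph is a \<^locale>\<open>pair_graph\<close>: an undirected edge \<open>xy\<close> is represented by the two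
  arcs \<open>(x, y)\<close> and \<open>(y, x)\<close>.
\<close>

definition commuting_graph :: "('a, 'b) monoid_scheme \<Rightarrow> 'a set \<Rightarrow> 'a pair_pre_digraph" where
  "commuting_graph H \<Gamma> =
    \<lparr> pverts = \<Gamma>,
      parcs = {(x, y). x \<in> \<Gamma> \<and> y \<in> \<Gamma> \<and> x \<noteq> y \<and> x \<otimes>\<^bsub>H\<^esub> y = y \<otimes>\<^bsub>H\<^esub> x} \<rparr>"

end

theory Submission
  imports Defs "HOL-Combinatorics.Transposition"
begin

text \<open>
  Take the right-angled Coxeter group of \<open>G\<close>: \<open>m\<^sub>i\<^sub>j = 2\<close> for adjacent \<open>i \<noteq> j\<close> and
  \<open>m\<^sub>i\<^sub>j = \<infinity>\<close> otherwise. Adjacent generators commute because \<open>xy\<close>, \<open>x\<close> and \<open>y\<close> are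
  involutions. To see that nothing else is identified, let the group act on \<open>\<nat>\<close>: mapping
  \<open>s\<^sub>i\<close> to a transposition and all other generators to the identity separates \<open>s\<^sub>i\<close> from
  them, and mapping \<open>s\<^sub>i\<close> and \<open>s\<^sub>j\<close> to \<open>(0 1)\<close> and \<open>(1 2)\<close>, the others to the identity, is
  compatible with the relators for nonadjacent \<open>i \<noteq> j\<close>, so \<open>s\<^sub>i\<close> and \<open>s\<^sub>j\<close> do not commute.
\<close>

text \<open>The exponent of a letter is ignored, since generators will only act by involutions.\<close>

definition word_act :: "('x \<Rightarrow> 'a \<Rightarrow> 'a) \<Rightarrow> 'x gword \<Rightarrow> 'a \<Rightarrow> 'a" where
  "word_act f w = foldr (\<lambda>(x, _) g. f x \<circ> g) w id"

lemma word_act_simps [simp]: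
  "word_act f [] = id"
  "word_act f ((x, b) # w) = f x \<circ> word_act f w"
  by (simp_all add: word_act_def)

lemma word_act_append: "word_act f (u @ v) = word_act f u \<circ> word_act f v"
  by (induction u) (auto simp: comp_assoc)

lemma word_act_power:
  "word_act f (concat (replicate m [(i, True), (j, True)])) = (f i \<circ> f j) ^^ m"
  by (induction m) (auto simp: comp_assoc)

text \<open>Induction over the rules generating the congruence. Since each \<open>f x\<close> is an
  involution, \<open>x\<close> and its inverse may act alike, which makes the \<open>cancel\<close>
  rule sound for both exponents.\<close>

lemma word_act_cong:
  assumes "(u, v) \<in> pres_cong X R"
    and "\<And>x. x \<in> X \<Longrightarrow> f x \<circ> f x = id"
    and "\<And>r. r \<in> R \<Longrightarrow> word_act f r = id"
  shows "word_act f u = word_act f v"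
  using assms(1)
  by (induction rule: pres_cong.induct) (auto simp: word_act_append assms(2,3))

lemma pres_cong_class_eq_iff:
  assumes "u \<in> gwords X" "v \<in> gwords X"
  shows "pres_cong X R `` {u} = pres_cong X R `` {v} \<longleftrightarrow> (u, v) \<in> pres_cong X R"
  using assms by (simp add: eq_equiv_class_iff[OF equiv_pres_cong])

text \<open>Involutions satisfying the defining relations extend to an action of the whole Coxeter
  group. Used in contrapositive form: words that act differently represent different
  elements.\<close>

lemma coxeter_group_class_eq_act:
  assumes "u \<in> gwords {1..n}" "v \<in> gwords {1..n}"
    and "pres_cong {1..n} (coxeter_relators n M) `` {u} =
      pres_cong {1..n} (coxeter_relators n M) `` {v}"
    and "\<And>i. i \<in> {1..n} \<Longrightarrow> f i \<circ> f i = id"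
    and "\<And>i j m. \<lbrakk>i \<in> {1..n}; j \<in> {1..n}; M i j = enat m\<rbrakk> \<Longrightarrow> (f i \<circ> f j) ^^ m = id"
  shows "word_act f u = word_act f v"
proof (rule word_act_cong)
  show "(u, v) \<in> pres_cong {1..n} (coxeter_relators n M)"
    using assms(1-3) by (simp add: pres_cong_class_eq_iff)
  show "word_act f r = id" if "r \<in> coxeter_relators n M" for r
    using that assms(5) by (auto simp: coxeter_relators_def word_act_power)
qed (fact assms(4))

lemma gen_word_in_gwords [simp]: "[(i, b)] \<in> gwords X \<longleftrightarrow> i \<in> X"
  "[(i, b), (j, c)] \<in> gwords X \<longleftrightarrow> i \<in> X \<and> j \<in> X"
  by (auto simp: gwords_def)

lemma coxeter_gen_mult:
  assumes "i \<in> {1..n}" "j \<in> {1..n}"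
  shows "coxeter_gen n M i \<otimes>\<^bsub>coxeter_group n M\<^esub> coxeter_gen n M j =
    pres_cong {1..n} (coxeter_relators n M) `` {[(i, True), (j, True)]}"
  using assms
  by (simp add: coxeter_gen_def coxeter_group_def pres_gen_def presented_group_mult)

lemma coxeter_gen_carrier:
  "i \<in> {1..n} \<Longrightarrow> coxeter_gen n M i \<in> carrier (coxeter_group n M)"
  by (auto simp: coxeter_gen_def coxeter_group_def pres_gen_def presented_group_def
      intro: quotientI)

lemma coxeter_relator_class:
  assumes "i \<in> {1..n}" "j \<in> {1..n}" "M i j = enat m"
  shows "pres_cong {1..n} (coxeter_relators n M) ``
    {concat (replicate m [(i, True), (j, True)])} = \<one>\<^bsub>coxeter_group n M\<^esub>"
proof -
  have "concat (replicate m [(i, True), (j, True)]) \<in> gwords {1..n}"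
    using assms(1,2) by (induction m) (simp_all add: gwords_def)
  moreover have "concat (replicate m [(i, True), (j, True)]) \<in> coxeter_relators n M"
    using assms by (auto simp: coxeter_relators_def)
  ultimately show ?thesis
    using equiv_class_eq[OF equiv_pres_cong pres_cong.relator]
    by (auto simp: coxeter_group_def presented_group_def)
qed

text \<open>An involution is its own inverse, so \<open>x \<otimes> y\<close> equals its inverse,
  which is \<open>inv y \<otimes> inv x\<close> and hence \<open>y \<otimes> x\<close>.\<close>

lemma (in group) involutions_commute:
  assumes "x \<in> carrier G" "y \<in> carrier G"
    and "x \<otimes> x = \<one>" "y \<otimes> y = \<one>" "(x \<otimes> y) \<otimes> (x \<otimes> y) = \<one>"
  shows "x \<otimes> y = y \<otimes> x"
proof -
  have "inv x = x" "inv y = y" "inv (x \<otimes> y) = x \<otimes> y"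
    using assms by (auto intro: inv_equality)
  then show ?thesis
    using inv_mult_group[of x y] assms(1,2) by simp
qed

lemma coxeter_gen_commute:
  assumes "coxeter_matrix n M" "i \<in> {1..n}" "j \<in> {1..n}" "M i j = 2"
  shows "coxeter_gen n M i \<otimes>\<^bsub>coxeter_group n M\<^esub> coxeter_gen n M j =
    coxeter_gen n M j \<otimes>\<^bsub>coxeter_group n M\<^esub> coxeter_gen n M i"
proof -
  interpret group "coxeter_group n M"
    unfolding coxeter_group_def by (rule group_presented_group)
  have square: "coxeter_gen n M k \<otimes>\<^bsub>coxeter_group n M\<^esub> coxeter_gen n M k = \<one>\<^bsub>coxeter_group n M\<^esub>"
    if "k \<in> {1..n}" for k
  proof -
    \<comment> \<open>The diagonal entry 1 contributes the relator with letters \<open>k\<close>,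
      \<open>k\<close>, which makes the generator an involution.\<close>
    have "M k k = enat 1"
      using assms(1) that by (simp add: coxeter_matrix_def one_enat_def)
    from coxeter_relator_class[where M = M, OF that that this] show ?thesis
      using that by (simp add: coxeter_gen_mult)
  qed
  \<comment> \<open>The relator is now the four-letter word \<open>i\<close>, \<open>j\<close>,
    \<open>i\<close>, \<open>j\<close>, that is, the square of the product of the two
    generators.\<close>
  have "M i j = enat 2"
    using assms(4) by (simp add: numeral_eq_enat)
  from coxeter_relator_class[where M = M, OF assms(2,3) this]
  have "(coxeter_gen n M i \<otimes>\<^bsub>coxeter_group n M\<^esub> coxeter_gen n M j) \<otimes>\<^bsub>coxeter_group n M\<^esub>
      (coxeter_gen n M i \<otimes>\<^bsub>coxeter_group n M\<^esub> coxeter_gen n M j) = \<one>\<^bsub>coxeter_group n M\<^esub>"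
    using assms(2,3)
    by (simp add: coxeter_gen_mult)
      (simp add: coxeter_group_def presented_group_mult numeral_2_eq_2)
  then show ?thesis
    using assms(2,3) by (intro involutions_commute square coxeter_gen_carrier)
qed

definition right_angled_matrix :: "(nat \<Rightarrow> nat \<Rightarrow> bool) \<Rightarrow> nat \<Rightarrow> nat \<Rightarrow> enat" where
  "right_angled_matrix A i j = (if i = j then 1 else if A i j then 2 else \<infinity>)"

lemma coxeter_matrix_right_angled:
  "symp A \<Longrightarrow> coxeter_matrix n (right_angled_matrix A)"
  by (auto simp: coxeter_matrix_def right_angled_matrix_def dest: sympD)

text \<open>Finite entries are 1 on the diagonal and 2 off it. On the diagonal the base
  \<open>f i \<circ> f i\<close> is already the identity; off it one factor is the identity, so the
  product is an involution or trivial.\<close>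

lemma right_angled_action:
  assumes "\<And>i. f i \<circ> f i = id"
    and "\<And>i j. A i j \<Longrightarrow> i \<noteq> j \<Longrightarrow> f i = id \<or> f j = id"
    and "right_angled_matrix A i j = enat m"
  shows "(f i \<circ> f j) ^^ m = id"
proof (cases "i = j")
  case True
  then show ?thesis using assms(1) by simp
next
  case False
  then have "m = 2" "A i j"
    using assms(3) by (auto simp: right_angled_matrix_def numeral_eq_enat split: if_splits)
  then show ?thesis
    using assms(1) assms(2)[OF \<open>A i j\<close> False] by (auto simp: numeral_2_eq_2)
qed

lemma right_angled_class_eq_act:
  assumes "u \<in> gwords {1..n}" "v \<in> gwords {1..n}"
    and "pres_cong {1..n} (coxeter_relators n (right_angled_matrix A)) `` {u} =
      pres_cong {1..n} (coxeter_relators n (right_angled_matrix A)) `` {v}"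
    and "\<And>i. f i \<circ> f i = id"
    and "\<And>i j. A i j \<Longrightarrow> i \<noteq> j \<Longrightarrow> f i = id \<or> f j = id"
  shows "word_act f u = word_act f v"
  using assms(1-4) right_angled_action[of f A, OF assms(4,5)]
  by (rule coxeter_group_class_eq_act)

lemma inj_on_coxeter_gen_right_angled:
  "inj_on (coxeter_gen n (right_angled_matrix A)) {1..n}"
proof (rule inj_onI, rule ccontr)
  fix i j
  assume ij: "i \<in> {1..n}" "j \<in> {1..n}"
    and eq: "coxeter_gen n (right_angled_matrix A) i = coxeter_gen n (right_angled_matrix A) j"
    and "i \<noteq> j"
  let ?f = "\<lambda>k. if k = i then transpose 0 1 else (id :: nat \<Rightarrow> nat)"
  have "word_act ?f [(i, True)] = word_act ?f [(j, True)]"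
    using eq
    by (intro right_angled_class_eq_act[where n = n and A = A])
      (use ij in \<open>auto simp: coxeter_gen_def pres_gen_def\<close>)
  \<comment> \<open>Evaluation at 0, which the image of \<open>i\<close> moves and that of
    \<open>j\<close> fixes.\<close>
  then have "transpose 0 1 (0 :: nat) = 0"
    using \<open>i \<noteq> j\<close> by (simp del: transpose_apply_first)
  then show False by simp
qed

lemma coxeter_gen_right_angled_commute_iff:
  assumes A: "symp A"
    and ij: "i \<in> {1..n}" "j \<in> {1..n}" "i \<noteq> j"
  defines "M \<equiv> right_angled_matrix A"
  shows "coxeter_gen n M i \<otimes>\<^bsub>coxeter_group n M\<^esub> coxeter_gen n M j =
    coxeter_gen n M j \<otimes>\<^bsub>coxeter_group n M\<^esub> coxeter_gen n M i \<longleftrightarrow> A i j"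
    (is "?commute \<longleftrightarrow> _")
proof
  assume "A i j"
  then have "M i j = 2"
    using ij(3) by (simp add: M_def right_angled_matrix_def)
  then show ?commute
    using coxeter_matrix_right_angled[OF A] ij by (intro coxeter_gen_commute) (simp_all add: M_def)
next
  assume ?commute
  show "A i j"
  proof (rule ccontr)
    assume "\<not> A i j"
    let ?f = "\<lambda>k. if k = i then transpose 0 1
      else if k = j then transpose 1 2 else (id :: nat \<Rightarrow> nat)"
    have "word_act ?f [(i, True), (j, True)] = word_act ?f [(j, True), (i, True)]"
    proof (rule right_angled_class_eq_act[where n = n and A = A])
      show "pres_cong {1..n} (coxeter_relators n (right_angled_matrix A)) `` {[(i, True), (j, True)]} =
          pres_cong {1..n} (coxeter_relators n (right_angled_matrix A)) `` {[(j, True), (i, True)]}"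
        using \<open>?commute\<close> unfolding coxeter_gen_mult[OF ij(1,2)] coxeter_gen_mult[OF ij(2,1)] M_def .
      \<comment> \<open>Both values are nontrivial only for the pair \<open>i\<close>,
        \<open>j\<close> in some order; symmetry of \<open>A\<close> excludes either order.\<close>
      show "?f k = id \<or> ?f l = id" if "A k l" "k \<noteq> l" for k l
        using that \<open>\<not> A i j\<close> sympD[OF A] by auto
    qed (use ij in auto)
    \<comment> \<open>The left side is 1 and the right side is 2.\<close>
    then have "(transpose 0 1 \<circ> transpose 1 2) (0 :: nat) = (transpose 1 2 \<circ> transpose 0 1) 0"
      using ij(3) by simp
    then show False by (simp add: transpose_def)
  qed
qed

text \<open>Arcs are ordered pairs of vertices, so the vertex bijection induces the arc map
  \<open>map_prod f f\<close>, which inherits injectivity.\<close>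

lemma digraph_iso_with_projI:
  assumes "pair_wf_digraph G" and "bij_betw f (pverts G) (pverts H)"
    and "parcs H = map_prod f f ` parcs G"
  shows "digraph_iso (with_proj G) (with_proj H)"
proof -
  interpret pair_wf_digraph G by fact
  let ?hom = "\<lparr>iso_verts = f, iso_arcs = map_prod f f, iso_head = snd, iso_tail = fst\<rparr>"
  have f: "inj_on f (pverts G)" "f ` pverts G = pverts H"
    using assms(2) by (auto simp: bij_betw_def)
  have "parcs G \<subseteq> pverts G \<times> pverts G"
    using arc_fst_in_verts arc_snd_in_verts by (intro subsetI) (simp add: mem_Times_iff)
  then have "inj_on (map_prod f f) (parcs G)"
    using f(1) by (blast intro: map_prod_inj_on inj_on_subset)
  then have "digraph_isomorphism ?hom"
    using f(1) wf_digraph_axioms by (simp add: digraph_isomorphism_def)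
  moreover have "with_proj H = app_iso ?hom (with_proj G)"
    using f(2) assms(3) by (simp add: app_iso_def with_proj_def)
  ultimately show ?thesis
    unfolding digraph_iso_def by blast
qed

theorem theorem3p1:
  fixes G :: "'v pair_pre_digraph" and n :: nat
  assumes "pair_graph G" and "card (pverts G) = n"
  shows "\<exists>M. coxeter_matrix n M \<and>
    digraph_iso (with_proj G)
      (with_proj (commuting_graph (coxeter_group n M) (coxeter_gen n M ` {1..n})))"
proof -
  interpret pair_graph G by fact
  obtain e where e: "bij_betw e {1..n} (pverts G)"
    using ex_bij_betw_nat_finite_1[OF pair_finite_verts] assms(2) by auto
  define A where "A i j \<longleftrightarrow> (e i, e j) \<in> parcs G" for i j
  define M where "M = right_angled_matrix A"
  let ?H = "commuting_graph (coxeter_group n M) (coxeter_gen n M ` {1..n})"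
  let ?g = "inv_into {1..n} e"
  have A: "symp A"
    using pair_sym_arcs by (auto simp: A_def symmetric_def intro!: sympI dest: symD)
  have s: "bij_betw (coxeter_gen n M) {1..n} (coxeter_gen n M ` {1..n})"
    unfolding M_def by (intro inj_on_imp_bij_betw inj_on_coxeter_gen_right_angled)
  have g: "?g (e i) = i" if "i \<in> {1..n}" for i
    using that e by (simp add: bij_betw_inv_into_left)
  \<comment> \<open>Both graphs are described as images of one set of index pairs, under
    \<open>e\<close> and under the generator map; the isomorphism is then the generator map after
    the inverse of \<open>e\<close>.\<close>
  have arcs: "parcs G = map_prod e e ` {(i, j). i \<in> {1..n} \<and> j \<in> {1..n} \<and> i \<noteq> j \<and> A i j}"
  proof (intro equalityI subsetI)
    fix a assume a: "a \<in> parcs G"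
    then obtain i j where "i \<in> {1..n}" "j \<in> {1..n}" "fst a = e i" "snd a = e j"
      using e arc_fst_in_verts arc_snd_in_verts by (metis bij_betw_imp_surj_on imageE)
    moreover from this have "a = map_prod e e (i, j)" by (simp add: prod_eq_iff)
    moreover have "i \<noteq> j"
      using calculation pair_no_loops[OF a] by auto
    ultimately show "a \<in> map_prod e e ` {(i, j). i \<in> {1..n} \<and> j \<in> {1..n} \<and> i \<noteq> j \<and> A i j}"
      using a by (intro image_eqI[of _ _ "(i, j)"]) (auto simp: A_def)
  qed (auto simp: A_def)
  have "parcs ?H = map_prod (coxeter_gen n M) (coxeter_gen n M) `
      {(i, j). i \<in> {1..n} \<and> j \<in> {1..n} \<and> i \<noteq> j \<and> A i j}"
    using coxeter_gen_right_angled_commute_iff[OF A, of _ n, folded M_def]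
      inj_on_eq_iff[OF bij_betw_imp_inj_on[OF s]]
    by (fastforce simp: commuting_graph_def image_iff)
  also have "\<dots> = map_prod (coxeter_gen n M \<circ> ?g) (coxeter_gen n M \<circ> ?g) ` parcs G"
    unfolding arcs image_image using g by (intro image_cong) auto
  finally have "digraph_iso (with_proj G) (with_proj ?H)"
    using bij_betw_trans[OF bij_betw_inv_into[OF e] s] pair_wf_digraph
    by (intro digraph_iso_with_projI) (simp_all add: commuting_graph_def)
  moreover have "coxeter_matrix n M"
    unfolding M_def using A by (rule coxeter_matrix_right_angled)
  ultimately show ?thesis by blast
qed

end
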